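(* Let $\mu$ be a positive measure on $\mathbb{R}^d$ and let $\mathcal{E}$ be an arbitrary countable collection of measurable sets with finite $\mu$-measure. Let $0<\eta<1$ and suppose that, with a constant $M<\infty$, $$\mu\bigl(\bigl\{x:\ \mathcal{M}_{\mathcal{E}}^{\mu}(\mathbbm{1}_E)(x)>\eta\bigr\}\bigr)\le M\,\mu(E)\qquad\text{for all measurable sets }E .$$ Then for any $0<\gamma<1-\eta$ there exists a partition of $\mathcal{E}$ into at most $$1+\frac{2M(1-\eta)}{1-\eta-\gamma}\,\|\mathcal{E}\|_{\mathrm{Carleson}(\mu)}$$ subcollections $\{\mathcal{E}_i\}$ satisfying $$\|\mathcal{E}_i\|_{\mathrm{Sparse}(\mu)}\ge\gamma\qquad\text{for every } i.$$
   Context: A collection is an unordered sequence of sets; repeated elements are allowed, and sums over a collection count multiplicity. For a collection $\mathcal{F}$ let $\mathrm{sh}(\mathcal{F})=\bigcup_{R\in\mathcal{F}}R$. The convention $\frac00=0$ is used. The Carleson constant of $\mathcal{E}$ with respect to $\mu$ is $$\|\mathcal{E}\|_{\mathrm{Carleson}(\mu)}=\sup\Bigl\{\frac{1}{\mu(\mathrm{sh}(\mathcal{F}))}\sum_{R\in\mathcal{F}}\mu(R):\ \mathcal{F}\subseteq\mathcal{E}\text{ finite}\Bigr\}.$$ $\mathcal{E}$ is $\eta'$-sparse with respect to $\mu$ if one can find measurable functions $\varphi_R\ge 0$, one for each $R$ in $\mathcal{E}$, such that $\int_R\varphi_R\,d\mu\ge\eta'\mu(R)$ for every $R\in\mathcal{E}$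 and $\sum_{R\in\mathcal{E}}\varphi_R\le 1$. The sparse constant is $$\|\mathcal{E}\|_{\mathrm{Sparse}(\mu)}=\sup\{\eta'\ge 0:\ \mathcal{E}\text{ is }\eta'\text{-sparse with respect to }\mu\}.$$ The maximal operator associated to $\mathcal{E}$ and $\mu$ is $$\mathcal{M}_{\mathcal{E}}^{\mu}f(x)=\sup_{R\in\mathcal{E}}\frac{\mathbbm{1}_R(x)}{\mu(R)}\int_R|f|\,d\mu .$$ *)

theory Defs
  imports "HOL-Analysis.Analysis" "HOL-Library.Disjoint_Sets"
begin

text \<open>
  A collection of sets, in which repetitions are allowed, is an indexed family \<open>R i\<close> with
  \<open>i \<in> I\<close>. Its subcollections are the restrictions of \<open>R\<close> to subsets of \<open>I\<close>, and its partitions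
  are the partitions of \<open>I\<close>. All constants take values in \<open>ennreal\<close>, where \<open>0 / 0 = 0\<close>.
\<close>

definition shadow :: "'i set \<Rightarrow> ('i \<Rightarrow> 'a set) \<Rightarrow> 'a set" where
  "shadow I R = (\<Union>i\<in>I. R i)"

definition carleson_const :: "'a measure \<Rightarrow> 'i set \<Rightarrow> ('i \<Rightarrow> 'a set) \<Rightarrow> ennreal" where
  "carleson_const \<mu> I R =
     (SUP F \<in> {F. F \<subseteq> I \<and> finite F}.
        (\<Sum>i\<in>F. emeasure \<mu> (R i)) / emeasure \<mu> (shadow F R))"

definition is_sparse :: "'a measure \<Rightarrow> 'i set \<Rightarrow> ('i \<Rightarrow> 'a set) \<Rightarrow> real \<Rightarrow> bool" where
  "is_sparse \<mu> I R \<eta>' \<longleftrightarrow>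
     (\<exists>\<phi> :: 'i \<Rightarrow> 'a \<Rightarrow> ennreal.
        (\<forall>i\<in>I. \<phi> i \<in> borel_measurable \<mu>) \<and>
        (\<forall>i\<in>I. (\<integral>\<^sup>+x\<in>R i. \<phi> i x \<partial>\<mu>) \<ge> ennreal \<eta>' * emeasure \<mu> (R i)) \<and>
        (\<forall>x\<in>space \<mu>. (\<Sum>\<^sub>\<infinity>i\<in>I. \<phi> i x) \<le> 1))"

text \<open>
  The supremum is infinite when all \<open>R i\<close> are null sets, in particular when \<open>I\<close> is empty.
\<close>

definition sparse_const :: "'a measure \<Rightarrow> 'i set \<Rightarrow> ('i \<Rightarrow> 'a set) \<Rightarrow> ennreal" where
  "sparse_const \<mu> I R = (SUP \<eta>' \<in> {\<eta>'. \<eta>' \<ge> 0 \<and> is_sparse \<mu> I R \<eta>'}. ennreal \<eta>')"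

definition maximal_op ::
  "'a measure \<Rightarrow> 'i set \<Rightarrow> ('i \<Rightarrow> 'a set) \<Rightarrow> ('a \<Rightarrow> real) \<Rightarrow> 'a \<Rightarrow> ennreal" where
  "maximal_op \<mu> I R f x =
     (SUP i\<in>I. indicator (R i) x * ((\<integral>\<^sup>+y\<in>R i. ennreal \<bar>f y\<bar> \<partial>\<mu>) / emeasure \<mu> (R i)))"

text \<open>The number of elements of a set, with value \<open>\<infinity>\<close> (and not \<open>0\<close>) for infinite sets.\<close>

definition num_elems :: "'a set \<Rightarrow> ennreal" where
  "num_elems A = (if finite A then of_nat (card A) else \<infinity>)"

end

theory Submission
  imports Defs
begin

text \<open>
  Let \<open>K = 2 M C\<close>, where \<open>C\<close> is the Carleson constant. In a finite subcollection the points
  covered more than \<open>K\<close> times form, by Chebyshev, a set \<open>B\<close> so small that the maximal function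
  of its indicator cannot exceed \<open>\<eta>\<close> on the whole shadow; hence some \<open>R\<close> satisfies
  \<open>\<mu>(R \<inter> B) \<le> \<eta> \<mu>(R)\<close>. Remove this \<open>R\<close>, split the rest by induction, and put \<open>R\<close> back as the
  last set. If it met the shadow of each of the \<open>N\<close> classes in more than \<open>(1 - \<gamma>) \<mu>(R)\<close>,
  integrating the number of shadows over \<open>R - B\<close> would bound \<open>N\<close> by
  \<open>K (1 - \<eta>) / (1 - \<eta> - \<gamma>)\<close>. So every set meets the earlier sets of its class
  in at most \<open>(1 - \<gamma>) \<mu>(R)\<close>, and removing them gives disjoint witnesses of sparseness.

  For a countable collection both the class and the order are passed to the limit along a
  subsequence of finite subcollections. The limit order need not be well-founded, but the
  witnesses only need that of any two sets one precedes the other.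
\<close>

section \<open>Diagonal extraction of a limit\<close>

text \<open>A diagonal argument: along an enumeration of \<open>J\<close> the pigeonhole principle
  gives nested infinite sets \<open>S m\<close> of stages, each fixing one more coordinate. A finite
  \<open>F\<close> is settled by a single \<open>S m\<close>. Asking only for infinitely many stages
  that agree on \<open>F\<close> avoids constructing a subsequence.\<close>

lemma countable_eventually_constant_limit:
  fixes f :: "nat \<Rightarrow> 'j \<Rightarrow> 'v"
  assumes J: "countable J" and fin: "\<And>j. j \<in> J \<Longrightarrow> finite (range (\<lambda>n. f n j))"
  shows "\<exists>g. \<forall>F\<subseteq>J. finite F \<longrightarrow> infinite {n. \<forall>j\<in>F. f n j = g j}"
proof (cases "J = {}")
  case True
  then show ?thesis by simp
next
  case False
  define Q :: "nat \<Rightarrow> nat set \<Rightarrow> bool" where "Q m S \<longleftrightarrow> infinite S" for m S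
  define T where "T m S S' \<longleftrightarrow> S' \<subseteq> S \<and> (\<exists>v. \<forall>n\<in>S'. f n (from_nat_into J m) = v)" for m S S'
  have "\<exists>S. \<forall>m. Q m (S m) \<and> T m (S m) (S (Suc m))"
  proof (rule dependent_nat_choice)
    show "\<exists>S. Q 0 S" unfolding Q_def by (rule exI[of _ UNIV]) simp
  next
    fix S m assume "Q m S"
    then have inf: "infinite S" by (simp add: Q_def)
    have "finite ((\<lambda>n. f n (from_nat_into J m)) ` S)"
      by (rule finite_subset[OF _ fin[OF from_nat_into[OF False, of m]]]) blast
    from pigeonhole_infinite[OF inf this] obtain n0 where
      "infinite {n \<in> S. f n (from_nat_into J m) = f n0 (from_nat_into J m)}" by blast
    then show "\<exists>S'. Q (Suc m) S' \<and> T m S S'"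
      unfolding Q_def T_def
      by (intro exI[of _ "{n \<in> S. f n (from_nat_into J m) = f n0 (from_nat_into J m)}"]) auto
  qed
  then obtain S where inf: "\<And>m. infinite (S m)" and sub: "\<And>m. S (Suc m) \<subseteq> S m"
    and ex: "\<And>m. \<exists>v. \<forall>n\<in>S (Suc m). f n (from_nat_into J m) = v"
    unfolding Q_def T_def by blast
  from ex obtain g where g: "\<And>m n. n \<in> S (Suc m) \<Longrightarrow> f n (from_nat_into J m) = g m" by metis
  have mono: "S m' \<subseteq> S m" if "m \<le> m'" for m m'
    using lift_Suc_antimono_le[of S, OF sub that] .
  have "infinite {n. \<forall>j\<in>F. f n j = g (to_nat_on J j)}" if F: "F \<subseteq> J" "finite F" for F
  proof -
    obtain m where m: "\<And>j. j \<in> F \<Longrightarrow> to_nat_on J j < m"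
      using finite_nat_set_iff_bounded[of "to_nat_on J ` F"] F(2) by auto
    have "f n j = g (to_nat_on J j)" if "n \<in> S m" "j \<in> F" for n j
    proof -
      have "n \<in> S (Suc (to_nat_on J j))"
        using mono[OF Suc_leI[OF m[OF \<open>j \<in> F\<close>]]] that(1) by (rule subsetD)
      moreover have "from_nat_into J (to_nat_on J j) = j"
        by (rule from_nat_into_to_nat_on[OF J]) (use F(1) that(2) in blast)
      ultimately show ?thesis using g[of n "to_nat_on J j"] by simp
    qed
    then have "S m \<subseteq> {n. \<forall>j\<in>F. f n j = g (to_nat_on J j)}" by blast
    then show ?thesis using inf by (rule infinite_super)
  qed
  then show ?thesis by (intro exI[of _ "\<lambda>j. g (to_nat_on J j)"]) blast
qed

section \<open>The maximal function and points of high multiplicity\<close>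

text \<open>A supremum exceeds \<eta> exactly when one of its terms does, and each term vanishes off
  its set. For countable \<open>I\<close> the superlevel set is therefore measurable, and it
  contains the shadow of every family whose averages all exceed \<eta>.\<close>

lemma superlevel_maximal_op_indicator:
  assumes E: "E \<in> sets \<mu>" and R: "\<And>i. i \<in> I \<Longrightarrow> R i \<in> sets \<mu>" and "0 \<le> \<eta>"
  shows "{x. maximal_op \<mu> I R (indicator E) x > ennreal \<eta>} =
    (\<Union>i\<in>{i\<in>I. emeasure \<mu> (R i \<inter> E) / emeasure \<mu> (R i) > ennreal \<eta>}. R i)"
proof -
  have int: "(\<integral>\<^sup>+y\<in>R i. ennreal \<bar>indicator E y\<bar> \<partial>\<mu>) = emeasure \<mu> (R i \<inter> E)" if "i \<in> I" for i
  proof -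
    have "(\<integral>\<^sup>+y\<in>R i. ennreal \<bar>indicator E y\<bar> \<partial>\<mu>) = (\<integral>\<^sup>+y. indicator (R i \<inter> E) y \<partial>\<mu>)"
      by (intro nn_integral_cong) (auto simp: indicator_def)
    then show ?thesis using E R[OF that] by simp
  qed
  have "ennreal \<eta> < indicator (R i) x * v \<longleftrightarrow> x \<in> R i \<and> ennreal \<eta> < v" for i x and v :: ennreal
    by (cases "x \<in> R i") auto
  then show ?thesis
    unfolding maximal_op_def less_SUP_iff by (auto simp: int[simplified])
qed

text \<open>Chebyshev: the counting function of \<open>F\<close> exceeds \<open>K\<close> on
  \<open>B\<close>, and its integral is the sum of the measures, which the Carleson constant
  controls by the shadow.\<close>

lemma measure_heavy_points_le:
  fixes \<mu> :: "'a measure"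
  assumes "finite F" "F \<subseteq> I" and R: "\<And>i. i \<in> F \<Longrightarrow> R i \<in> sets \<mu>"
    and fin: "\<And>i. i \<in> F \<Longrightarrow> emeasure \<mu> (R i) < \<infinity>"
    and B: "B = {x \<in> space \<mu>. K < (\<Sum>i\<in>F. indicator (R i) x)}"
  shows "K * emeasure \<mu> B \<le> carleson_const \<mu> I R * emeasure \<mu> (shadow F R)"
proof -
  have [measurable]: "B \<in> sets \<mu>" unfolding B using R by measurable
  have sh: "shadow F R \<in> sets \<mu>" unfolding shadow_def using R \<open>finite F\<close> by auto
  have sh_fin: "emeasure \<mu> (shadow F R) < \<infinity>"
    unfolding shadow_def
    by (rule le_less_trans[OF emeasure_subadditive_finite]) (use assms in auto)
  have "K * emeasure \<mu> B = (\<integral>\<^sup>+x. K * indicator B x \<partial>\<mu>)"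
    by (simp add: nn_integral_cmult_indicator)
  also have "\<dots> \<le> (\<integral>\<^sup>+x. (\<Sum>i\<in>F. indicator (R i) x) \<partial>\<mu>)"
    by (intro nn_integral_mono) (auto simp: B indicator_def)
  also have "\<dots> = (\<Sum>i\<in>F. emeasure \<mu> (R i))"
    using R by (subst nn_integral_sum) auto
  finally have 1: "K * emeasure \<mu> B \<le> (\<Sum>i\<in>F. emeasure \<mu> (R i))" .
  show ?thesis
  proof (cases "emeasure \<mu> (shadow F R) = 0")
    \<comment> \<open>Here the Carleson quotient is 0 / 0 = 0 and says nothing about the sum, but
      every \<open>R i\<close> lies in a null shadow.\<close>
    case True
    have "emeasure \<mu> (R i) = 0" if "i \<in> F" for i
      using emeasure_eq_0[OF sh True, of "R i"] that by (auto simp: shadow_def)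
    then show ?thesis using 1 True by auto
  next
    case False
    have "(\<Sum>i\<in>F. emeasure \<mu> (R i)) / emeasure \<mu> (shadow F R) \<le> carleson_const \<mu> I R"
      unfolding carleson_const_def by (rule SUP_upper) (use assms in auto)
    then have "(\<Sum>i\<in>F. emeasure \<mu> (R i)) / emeasure \<mu> (shadow F R) * emeasure \<mu> (shadow F R)
        \<le> carleson_const \<mu> I R * emeasure \<mu> (shadow F R)"
      by (rule mult_right_mono) simp
    then have "(\<Sum>i\<in>F. emeasure \<mu> (R i)) \<le> carleson_const \<mu> I R * emeasure \<mu> (shadow F R)"
      using False sh_fin by (simp add: ennreal_divide_times ennreal_mult_divide_eq)
    with 1 show ?thesis by (rule order_trans)
  qed
qed

lemma carleson_const_ge_1:
  assumes "i \<in> I" "emeasure \<mu> (R i) > 0" "emeasure \<mu> (R i) < \<infinity>"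
  shows "1 \<le> carleson_const \<mu> I R"
  unfolding carleson_const_def
  by (rule SUP_upper2[of "{i}"]) (use assms in \<open>auto simp: shadow_def ennreal_divide_self\<close>)

text \<open>Otherwise the whole shadow, of measure s, lies in the superlevel set for
  \<open>B\<close>, so s <= M \<mu>(B), while Chebyshev gives 2 M C \<mu>(B) <= C s. Together 2 M C
  s <= M C s, which the factor 2 in the threshold makes absurd.\<close>

lemma exists_set_with_few_heavy_points:
  fixes \<mu> :: "'a measure"
  assumes "countable I" and R: "\<And>i. i \<in> I \<Longrightarrow> R i \<in> sets \<mu>"
    and fin: "\<And>i. i \<in> I \<Longrightarrow> emeasure \<mu> (R i) < \<infinity>"
    and pos: "\<And>i. i \<in> F \<Longrightarrow> emeasure \<mu> (R i) > 0"
    and "0 \<le> \<eta>"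
    and weak: "\<And>E. E \<in> sets \<mu> \<Longrightarrow>
           emeasure \<mu> {x. maximal_op \<mu> I R (indicator E) x > ennreal \<eta>} \<le> M * emeasure \<mu> E"
    and MC: "M * carleson_const \<mu> I R < \<infinity>"
    and F: "finite F" "F \<subseteq> I" "F \<noteq> {}"
    and B: "B = {x \<in> space \<mu>. 2 * M * carleson_const \<mu> I R < (\<Sum>i\<in>F. indicator (R i) x)}"
  shows "\<exists>i\<in>F. emeasure \<mu> (R i \<inter> B) \<le> ennreal \<eta> * emeasure \<mu> (R i)"
proof (rule ccontr)
  assume "\<not> ?thesis"
  then have heavy: "\<And>i. i \<in> F \<Longrightarrow> emeasure \<mu> (R i \<inter> B) > ennreal \<eta> * emeasure \<mu> (R i)"
    by (auto simp: not_le)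
  have RF: "\<And>i. i \<in> F \<Longrightarrow> R i \<in> sets \<mu>" using R F by auto
  have superlevel_sets: "{x. maximal_op \<mu> I R (indicator E) x > ennreal \<eta>} \<in> sets \<mu>"
    if "E \<in> sets \<mu>" for E
    using \<open>countable I\<close> R \<open>0 \<le> \<eta>\<close>
    by (subst superlevel_maximal_op_indicator[OF that]) auto
  have dominated: "emeasure \<mu> (shadow F R) \<le> M * emeasure \<mu> E" if E: "E \<in> sets \<mu>"
    and large: "\<And>i. i \<in> F \<Longrightarrow> emeasure \<mu> (R i \<inter> E) > ennreal \<eta> * emeasure \<mu> (R i)" for E
  proof -
    have "emeasure \<mu> (R i \<inter> E) / emeasure \<mu> (R i) > ennreal \<eta>" if "i \<in> F" for i
    proof (rule ccontr)
      assume "\<not> ?thesis"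
      then have "emeasure \<mu> (R i \<inter> E) / emeasure \<mu> (R i) * emeasure \<mu> (R i) \<le> ennreal \<eta> * emeasure \<mu> (R i)"
        by (intro mult_right_mono) auto
      moreover have "emeasure \<mu> (R i \<inter> E) / emeasure \<mu> (R i) * emeasure \<mu> (R i) = emeasure \<mu> (R i \<inter> E)"
        using pos[OF that] fin[of i] that F
        by (subst ennreal_divide_times) (auto simp: ennreal_mult_divide_eq)
      ultimately show False using large[OF that] by simp
    qed
    then have "shadow F R \<subseteq> {x. maximal_op \<mu> I R (indicator E) x > ennreal \<eta>}"
      using F \<open>0 \<le> \<eta>\<close> by (subst superlevel_maximal_op_indicator[OF E R]) (auto simp: shadow_def)
    then show ?thesis
      using emeasure_mono[OF _ superlevel_sets[OF E]] weak[OF E] by (meson order_trans)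
  qed
  have B_sets: "B \<in> sets \<mu>" unfolding B using RF by measurable
  define C where "C = carleson_const \<mu> I R"
  define s where "s = emeasure \<mu> (shadow F R)"
  have shadow_sets: "shadow F R \<in> sets \<mu>" unfolding shadow_def using RF F by auto
  obtain j where j: "j \<in> F" using F by auto
  have "emeasure \<mu> (R j) \<le> s"
    unfolding s_def by (rule emeasure_mono) (use j shadow_sets in \<open>auto simp: shadow_def\<close>)
  then have s_pos: "s > 0" using pos[OF j] by (rule less_le_trans[rotated])
  have s_fin: "s < \<infinity>"
    unfolding s_def shadow_def
    by (rule le_less_trans[OF emeasure_subadditive_finite]) (use RF fin F in auto)
  have "1 \<le> C" unfolding C_def by (rule carleson_const_ge_1[of j]) (use j F pos fin in auto)
  have sB: "s \<le> M * emeasure \<mu> B" unfolding s_def by (rule dominated[OF B_sets heavy])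
  \<comment> \<open>The final cancellation needs M C s to be nonzero as well as finite. Since
    \<open>s\<close> is positive, \<open>sB\<close> excludes M = 0, and the single set
    \<open>R j\<close> already forces C >= 1.\<close>
  have MC_pos: "M * C \<noteq> 0" using sB s_pos \<open>1 \<le> C\<close> by auto
  have "2 * M * C * s \<le> 2 * M * C * (M * emeasure \<mu> B)" using sB by (rule mult_left_mono) simp
  also have "\<dots> = M * (2 * M * C * emeasure \<mu> B)" by (simp add: ac_simps)
  also have "\<dots> \<le> M * (C * s)"
    using measure_heavy_points_le[OF F(1,2) RF _ B] fin F
    by (intro mult_left_mono) (auto simp: C_def s_def)
  finally have le: "2 * (M * C * s) \<le> M * C * s" by (simp add: ac_simps)
  have "M * C * s < \<infinity>" using MC s_fin by (simp add: C_def ennreal_mult_less_top)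
  moreover have "M * C * s \<noteq> 0" using MC_pos s_pos by auto
  moreover have "M * C * s + M * C * s \<le> M * C * s + 0" using le by (simp add: mult_2)
  ultimately show False unfolding ennreal_add_left_cancel_le by auto
qed

section \<open>A class for the last set\<close>

text \<open>Off \<open>B\<close> a point lies in at most \<open>K\<close> sets of \<open>F\<close>,
  hence in at most \<open>K\<close> class shadows \<open>S q\<close>. With a = \<mu>(R i) and g =
  \<mu>(R i - B), large overlaps with all \<open>N\<close> classes would give N (g - \<gamma> a) < K
  g. Since g >= (1 - \<eta>) a, the choice of \<open>N\<close> forbids this.\<close>

lemma exists_class_with_small_overlap:
  fixes \<mu> :: "'a measure" and c :: "'i \<Rightarrow> nat"
  assumes "finite F" and R: "\<And>i. i \<in> F \<Longrightarrow> R i \<in> sets \<mu>"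
    and "i \<in> F" and pos: "emeasure \<mu> (R i) > 0" and fin: "emeasure \<mu> (R i) < \<infinity>"
    and "0 \<le> K" and B: "B = {x \<in> space \<mu>. ennreal K < (\<Sum>i\<in>F. indicator (R i) x)}"
    and light: "emeasure \<mu> (R i \<inter> B) \<le> ennreal \<eta> * emeasure \<mu> (R i)"
    and par: "0 \<le> \<eta>" "0 < \<gamma>" "\<gamma> < 1 - \<eta>"
    and "0 < N" and N: "K * (1 - \<eta>) \<le> real N * (1 - \<eta> - \<gamma>)"
  shows "\<exists>q<N. emeasure \<mu> (R i \<inter> (\<Union>k\<in>{k\<in>F - {i}. c k = q}. R k)) \<le> ennreal (1 - \<gamma>) * emeasure \<mu> (R i)"
proof (rule ccontr)
  define S where "S q = (\<Union>k\<in>{k\<in>F - {i}. c k = q}. R k)" for q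
  assume "\<not> ?thesis"
  then have large: "\<And>q. q < N \<Longrightarrow> emeasure \<mu> (R i \<inter> S q) > ennreal (1 - \<gamma>) * emeasure \<mu> (R i)"
    by (auto simp: S_def not_le)
  have [measurable]: "B \<in> sets \<mu>" unfolding B using R by measurable
  have [measurable]: "S q \<in> sets \<mu>" for q
    unfolding S_def using R \<open>finite F\<close> by (intro sets.finite_UN) simp_all
  have [measurable]: "R i \<in> sets \<mu>" using R \<open>i \<in> F\<close> by auto
  define a where "a = measure \<mu> (R i)"
  define g where "g = measure \<mu> (R i - B)"
  have fm: "R i \<in> fmeasurable \<mu>" by (intro fmeasurableI) (use fin in auto)
  have fin_sub: "emeasure \<mu> X = ennreal (measure \<mu> X)" if "X \<subseteq> R i" "X \<in> sets \<mu>" for X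
    using fmeasurableI2[OF fm that] emeasure_eq_measure2 by blast
  have ea: "emeasure \<mu> (R i) = ennreal a" unfolding a_def by (rule fin_sub) auto
  have a_pos: "0 < a" using pos ea by simp
  have split: "measure \<mu> (R i \<inter> X) = measure \<mu> (R i \<inter> X \<inter> B) + measure \<mu> ((R i \<inter> X) - B)"
    if "X \<in> sets \<mu>" for X
  proof -
    have "R i \<inter> X = (R i \<inter> X \<inter> B) \<union> (R i \<inter> X - B)" by auto
    moreover have "measure \<mu> ((R i \<inter> X \<inter> B) \<union> (R i \<inter> X - B)) =
        measure \<mu> (R i \<inter> X \<inter> B) + measure \<mu> (R i \<inter> X - B)"
      using that by (intro measure_Union) (auto simp: fin_sub le_infI1 Diff_subset_conv)
    ultimately show ?thesis by simp
  qed
  have b: "measure \<mu> (R i \<inter> B) \<le> \<eta> * a"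
    using light fin_sub[of "R i \<inter> B"] par a_pos ea by (simp flip: ennreal_mult)
  have ab: "a = measure \<mu> (R i \<inter> B) + g"
    using split[of "R i"] by (simp add: a_def g_def)
  \<comment> \<open>At most a - g of the overlap can lie in \<open>B\<close>, and (1 - \<gamma>) a -
    (a - g) = g - \<gamma> a.\<close>
  have large_light: "measure \<mu> (R i \<inter> S q - B) > g - \<gamma> * a" if "q < N" for q
  proof -
    have "measure \<mu> (R i \<inter> S q) > (1 - \<gamma>) * a"
      using large[OF that] fin_sub[of "R i \<inter> S q"] par a_pos ea
      by (simp add: ennreal_less_iff flip: ennreal_mult)
    moreover have "measure \<mu> (R i \<inter> S q \<inter> B) \<le> measure \<mu> (R i \<inter> B)"
      by (rule measure_mono_fmeasurable) (auto intro!: fmeasurableI2[OF fm])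
    ultimately show ?thesis using split[of "S q"] ab by (simp add: algebra_simps)
  qed
  have "(\<Sum>q<N. emeasure \<mu> (R i \<inter> S q - B)) = (\<integral>\<^sup>+x. (\<Sum>q<N. indicator (R i \<inter> S q - B) x) \<partial>\<mu>)"
    by (subst nn_integral_sum) auto
  also have "\<dots> \<le> (\<integral>\<^sup>+x. ennreal K * indicator (R i - B) x \<partial>\<mu>)"
  proof (rule nn_integral_mono)
    fix x assume x: "x \<in> space \<mu>"
    show "(\<Sum>q<N. indicator (R i \<inter> S q - B) x) \<le> ennreal K * indicator (R i - B) x"
    proof (cases "x \<in> R i - B")
      case True
      \<comment> \<open>Each \<open>S q\<close> containing \<open>x\<close> has a member of class
        \<open>q\<close> through \<open>x\<close>. The classes are disjoint, so no member is counted
        twice.\<close>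
      have "(\<Sum>q<N. indicator (R i \<inter> S q - B) x) \<le>
          (\<Sum>q<N. \<Sum>k\<in>{k\<in>F. c k = q}. indicator (R k) x :: ennreal)"
      proof (rule sum_mono)
        fix q
        show "indicator (R i \<inter> S q - B) x \<le> (\<Sum>k\<in>{k\<in>F. c k = q}. indicator (R k) x :: ennreal)"
        proof (cases "x \<in> S q")
          case True
          then obtain k where k: "k \<in> {k\<in>F. c k = q}" "x \<in> R k" by (auto simp: S_def)
          have "indicator (R i \<inter> S q - B) x \<le> (indicator (R k) x :: ennreal)"
            using k by (auto simp: indicator_def)
          also have "\<dots> \<le> (\<Sum>k\<in>{k\<in>F. c k = q}. indicator (R k) x)"
            by (rule member_le_sum) (use k \<open>finite F\<close> in auto)
          finally show ?thesis .
        qed auto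
      qed
      also have "\<dots> = (\<Sum>k\<in>(\<Union>q<N. {k\<in>F. c k = q}). indicator (R k) x)"
        by (rule sum.UNION_disjoint[symmetric]) (use \<open>finite F\<close> in auto)
      also have "\<dots> \<le> (\<Sum>k\<in>F. indicator (R k) x)"
        by (rule sum_mono2) (use \<open>finite F\<close> in auto)
      also have "\<dots> \<le> ennreal K"
        using True x by (auto simp: B not_less)
      finally show ?thesis using True by simp
    next
      case False
      then show ?thesis by (auto simp: indicator_def)
    qed
  qed
  also have "\<dots> = ennreal K * emeasure \<mu> (R i - B)"
    by (simp add: nn_integral_cmult_indicator)
  also have "\<dots> = ennreal (K * g)"
    using fin_sub[of "R i - B"] \<open>0 \<le> K\<close> by (simp add: g_def ennreal_mult)
  also have "(\<Sum>q<N. emeasure \<mu> (R i \<inter> S q - B)) = ennreal (\<Sum>q<N. measure \<mu> (R i \<inter> S q - B))"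
  proof -
    have "emeasure \<mu> (R i \<inter> S q - B) = ennreal (measure \<mu> (R i \<inter> S q - B))" for q
      by (rule fin_sub) auto
    then show ?thesis by simp
  qed
  finally have upper: "(\<Sum>q<N. measure \<mu> (R i \<inter> S q - B)) \<le> K * g"
    using \<open>0 \<le> K\<close> by (simp add: ennreal_le_iff g_def)
  have "real N * (g - \<gamma> * a) = (\<Sum>q<N. g - \<gamma> * a)" by simp
  also have "\<dots> < (\<Sum>q<N. measure \<mu> (R i \<inter> S q - B))"
    by (rule sum_strict_mono) (use large_light \<open>0 < N\<close> in auto)
  finally have strict: "real N * (g - \<gamma> * a) < K * g" using upper by linarith
  \<comment> \<open>Only a lower bound for \<open>g\<close> is known, so (N - K) g must be
    nondecreasing in \<open>g\<close>.\<close>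
  have KN: "K \<le> real N"
  proof -
    have "K * (1 - \<eta>) \<le> real N * (1 - \<eta> - \<gamma>)" by (rule N)
    also have "\<dots> \<le> real N * (1 - \<eta>)" using par by (intro mult_left_mono) simp_all
    finally have "K * (1 - \<eta>) \<le> real N * (1 - \<eta>)" .
    then show ?thesis using par by simp
  qed
  have "g \<ge> (1 - \<eta>) * a" using ab b by (simp add: algebra_simps)
  \<comment> \<open>The two nonnegative products add up to N (g - \<gamma> a) - K g, which
    \<open>strict\<close> makes negative.\<close>
  then have "(real N - K) * (g - (1 - \<eta>) * a) \<ge> 0" using KN by simp
  moreover have "(real N * (1 - \<eta> - \<gamma>) - K * (1 - \<eta>)) * a \<ge> 0" using N a_pos by simp
  ultimately show False using strict by (simp add: algebra_simps)
qed

section \<open>Classes and orders for finite collections\<close>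

text \<open>
  In \<open>disjointifiable \<mu> \<epsilon> F R c r\<close> the class of \<open>i\<close> is \<open>c i\<close>, and \<open>(k, i) \<in> r\<close> means that \<open>k\<close>
  precedes \<open>i\<close>. Without transitivity the predicate involves only pairs of indices, which is
  what the passage to the limit needs.
\<close>

definition disjointifiable ::
  "'a measure \<Rightarrow> real \<Rightarrow> 'i set \<Rightarrow> ('i \<Rightarrow> 'a set) \<Rightarrow> ('i \<Rightarrow> nat) \<Rightarrow> ('i \<times> 'i) set \<Rightarrow> bool" where
  "disjointifiable \<mu> \<epsilon> F R c r \<longleftrightarrow> total_on F r \<and>
     (\<forall>i\<in>F. emeasure \<mu> (R i \<inter> (\<Union>k\<in>{k\<in>F - {i}. c k = c i \<and> (k, i) \<in> r}. R k))
        \<le> ennreal \<epsilon> * emeasure \<mu> (R i))"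

text \<open>Lets the limit data be exchanged, on a finite set, for those of one stage.\<close>

lemma disjointifiable_cong:
  assumes "\<And>i. i \<in> F \<Longrightarrow> c i = c' i"
    and "\<And>i k. i \<in> F \<Longrightarrow> k \<in> F \<Longrightarrow> (i, k) \<in> r \<longleftrightarrow> (i, k) \<in> r'"
  shows "disjointifiable \<mu> \<epsilon> F R c r \<longleftrightarrow> disjointifiable \<mu> \<epsilon> F R c' r'"
proof -
  have "{k\<in>F - {i}. c k = c i \<and> (k, i) \<in> r} = {k\<in>F - {i}. c' k = c' i \<and> (k, i) \<in> r'}"
    if "i \<in> F" for i
    using assms that by auto
  then show ?thesis unfolding disjointifiable_def total_on_def using assms by auto
qed

lemma disjointifiable_subset:
  assumes "disjointifiable \<mu> \<epsilon> F R c r" "G \<subseteq> F" "finite F" "\<And>i. i \<in> F \<Longrightarrow> R i \<in> sets \<mu>"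
  shows "disjointifiable \<mu> \<epsilon> G R c r"
  unfolding disjointifiable_def
proof (intro conjI ballI)
  show "total_on G r" using assms(1,2) unfolding disjointifiable_def total_on_def by blast
  fix i assume i: "i \<in> G"
  have "emeasure \<mu> (R i \<inter> (\<Union>k\<in>{k\<in>G - {i}. c k = c i \<and> (k, i) \<in> r}. R k)) \<le>
     emeasure \<mu> (R i \<inter> (\<Union>k\<in>{k\<in>F - {i}. c k = c i \<and> (k, i) \<in> r}. R k))"
    using assms i by (intro emeasure_mono) (auto intro!: sets.Int sets.finite_UN)
  also have "\<dots> \<le> ennreal \<epsilon> * emeasure \<mu> (R i)"
    using assms i by (auto simp: disjointifiable_def)
  finally show "emeasure \<mu> (R i \<inter> (\<Union>k\<in>{k\<in>G - {i}. c k = c i \<and> (k, i) \<in> r}. R k))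
    \<le> ennreal \<epsilon> * emeasure \<mu> (R i)" .
qed

text \<open>In \<open>last\<close> the index \<open>i\<close> is chosen before the colouring
  \<open>c\<close>: the induction first removes \<open>i\<close>, then colours the rest, and only
  then picks the class \<open>q\<close> for \<open>i\<close>.\<close>

lemma finite_disjointifiable:
  assumes "finite F" "0 < N"
    and last: "\<And>G. G \<subseteq> F \<Longrightarrow> G \<noteq> {} \<Longrightarrow> \<exists>i\<in>G. \<forall>c::'i \<Rightarrow> nat. \<exists>q<N.
      emeasure \<mu> (R i \<inter> (\<Union>k\<in>{k\<in>G - {i}. c k = q}. R k)) \<le> ennreal \<epsilon> * emeasure \<mu> (R i)"
  shows "\<exists>c r. range c \<subseteq> {..<N} \<and> disjointifiable \<mu> \<epsilon> F R c r"
  using assms(1,3)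
proof (induction F rule: finite_psubset_induct)
  case (psubset F)
  show ?case
  proof (cases "F = {}")
    case True
    then show ?thesis
      using \<open>0 < N\<close> by (intro exI[of _ "\<lambda>_. 0"] exI[of _ "{}"]) (auto simp: disjointifiable_def)
  next
    case False
    from psubset.prems[OF order_refl False] obtain i where i: "i \<in> F"
      and iq: "\<And>c::'i \<Rightarrow> nat. \<exists>q<N. emeasure \<mu> (R i \<inter> (\<Union>k\<in>{k\<in>F - {i}. c k = q}. R k))
        \<le> ennreal \<epsilon> * emeasure \<mu> (R i)" by blast
    have "\<exists>c r. range c \<subseteq> {..<N} \<and> disjointifiable \<mu> \<epsilon> (F - {i}) R c r"
    proof (rule psubset.IH)
      show "F - {i} \<subset> F" using i by auto
    qed (rule psubset.prems, auto)
    then obtain c r where c: "range c \<subseteq> {..<N}" and cr: "disjointifiable \<mu> \<epsilon> (F - {i}) R c r"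
      by blast
    obtain q where q: "q < N" "emeasure \<mu> (R i \<inter> (\<Union>k\<in>{k\<in>F - {i}. c k = q}. R k))
        \<le> ennreal \<epsilon> * emeasure \<mu> (R i)" using iq by blast
    define c' where "c' = c(i := q)"
    \<comment> \<open>\<open>i\<close> now follows every other index and precedes none of them, so
      giving it class \<open>q\<close> leaves the predecessors of the others unchanged.\<close>
    define r' where "r' = (r - {i} \<times> UNIV) \<union> UNIV \<times> {i}"
    have "total_on F r'"
      using cr by (auto simp: disjointifiable_def total_on_def r'_def)
    moreover have "emeasure \<mu> (R j \<inter> (\<Union>k\<in>{k\<in>F - {j}. c' k = c' j \<and> (k, j) \<in> r'}. R k))
        \<le> ennreal \<epsilon> * emeasure \<mu> (R j)" if "j \<in> F" for j
    proof (cases "j = i")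
      case True
      then have "{k\<in>F - {j}. c' k = c' j \<and> (k, j) \<in> r'} = {k\<in>F - {i}. c k = q}"
        by (auto simp: c'_def r'_def)
      then show ?thesis using q True by simp
    next
      case False
      then have "{k\<in>F - {j}. c' k = c' j \<and> (k, j) \<in> r'} =
          {k\<in>F - {i} - {j}. c k = c j \<and> (k, j) \<in> r}"
        by (auto simp: c'_def r'_def)
      then show ?thesis using cr that False by (simp add: disjointifiable_def)
    qed
    ultimately have "disjointifiable \<mu> \<epsilon> F R c' r'" by (auto simp: disjointifiable_def)
    moreover have "range c' \<subseteq> {..<N}" using c q by (auto simp: c'_def)
    ultimately show ?thesis by blast
  qed
qed

section \<open>Passage to countable collections\<close>

lemma finite_to_nat_on_less:
  assumes "countable I"
  shows "finite {i\<in>I. to_nat_on I i < n}"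
proof -
  have "inj_on (to_nat_on I) {i\<in>I. to_nat_on I i < n}"
    using inj_on_to_nat_on[OF assms] by (rule inj_on_subset) auto
  then show ?thesis by (rule inj_on_finite[where B="{..<n}"]) auto
qed

text \<open>A set may have infinitely many predecessors. The bound holds for finitely many of them
  at a time and passes to their union by continuity from below. Totality concerns only two indices
  at once.\<close>

lemma disjointifiable_if_finite_subsets:
  assumes "countable I" and R: "\<And>i. i \<in> I \<Longrightarrow> R i \<in> sets \<mu>"
    and fin: "\<And>F. F \<subseteq> I \<Longrightarrow> finite F \<Longrightarrow> disjointifiable \<mu> \<epsilon> F R c r"
  shows "disjointifiable \<mu> \<epsilon> I R c r"
  unfolding disjointifiable_def
proof (intro conjI ballI)
  show "total_on I r"
    unfolding total_on_def
  proof (intro ballI impI)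
    fix i k assume "i \<in> I" "k \<in> I" "i \<noteq> k"
    then show "(i, k) \<in> r \<or> (k, i) \<in> r"
      using fin[of "{i, k}"] by (simp add: disjointifiable_def total_on_def)
  qed
  fix i assume i: "i \<in> I"
  \<comment> \<open>Inserting \<open>i\<close> makes its overlap bound available for every
    \<open>n\<close>, also before the enumeration reaches \<open>i\<close>.\<close>
  define G where "G n = insert i {k\<in>I. to_nat_on I k < n}" for n
  define A where "A n = R i \<inter> (\<Union>k\<in>{k\<in>G n - {i}. c k = c i \<and> (k, i) \<in> r}. R k)" for n
  have G: "finite (G n)" "G n \<subseteq> I" for n
    unfolding G_def using finite_to_nat_on_less[OF \<open>countable I\<close>] i by simp_all
  have A_sets: "A n \<in> sets \<mu>" for n
    unfolding A_def using G[of n] R i by (intro sets.Int sets.finite_UN) auto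
  have "G m \<subseteq> G n" if "m \<le> n" for m n
    using that by (auto simp: G_def)
  then have "incseq A"
    unfolding incseq_def A_def by blast
  have "(\<Union>n. G n) = I"
    using i by (auto simp: G_def)
  then have "R i \<inter> (\<Union>k\<in>{k\<in>I - {i}. c k = c i \<and> (k, i) \<in> r}. R k) = (\<Union>n. A n)"
    unfolding A_def by blast
  also have "emeasure \<mu> (\<Union>n. A n) = (SUP n. emeasure \<mu> (A n))"
    using A_sets \<open>incseq A\<close> by (intro SUP_emeasure_incseq[symmetric]) auto
  also have "\<dots> \<le> ennreal \<epsilon> * emeasure \<mu> (R i)"
  proof (rule SUP_least)
    fix n
    have "i \<in> G n" by (simp add: G_def)
    with fin[OF G(2,1)[of n]] show "emeasure \<mu> (A n) \<le> ennreal \<epsilon> * emeasure \<mu> (R i)"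
      unfolding disjointifiable_def A_def by blast
  qed
  finally show "emeasure \<mu> (R i \<inter> (\<Union>k\<in>{k\<in>I - {i}. c k = c i \<and> (k, i) \<in> r}. R k))
    \<le> ennreal \<epsilon> * emeasure \<mu> (R i)" .
qed

text \<open>The values of \<open>g\<close> pair a class with an order bit, so one extraction handles
  both; the class of \<open>i\<close> is read at \<open>(i, i)\<close>. For finite \<open>F\<close>,
  infinitely many stages agree with \<open>g\<close> on \<open>F \<times> F\<close>, so one of them
  is late enough that its initial segment contains \<open>F\<close>.\<close>

lemma disjointifiable_limit:
  fixes c :: "nat \<Rightarrow> 'i \<Rightarrow> nat"
  assumes "countable I" and R: "\<And>i. i \<in> I \<Longrightarrow> R i \<in> sets \<mu>"
    and cr: "\<And>n. disjointifiable \<mu> \<epsilon> {i\<in>I. to_nat_on I i < n} R (c n) (r n)"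
    and g: "\<And>X. X \<subseteq> I \<times> I \<Longrightarrow> finite X \<Longrightarrow> infinite {n. \<forall>x\<in>X. (c n (fst x), x \<in> r n) = g x}"
  shows "disjointifiable \<mu> \<epsilon> I R (\<lambda>i. fst (g (i, i))) {x. snd (g x)}"
proof (rule disjointifiable_if_finite_subsets[OF \<open>countable I\<close> R])
  fix F assume F: "F \<subseteq> I" "finite F"
  obtain m where m: "\<And>i. i \<in> F \<Longrightarrow> to_nat_on I i < m"
    using finite_nat_set_iff_bounded[of "to_nat_on I ` F"] F by auto
  have "infinite {n. \<forall>x\<in>F \<times> F. (c n (fst x), x \<in> r n) = g x}"
    using F by (intro g) auto
  then obtain n where n: "m \<le> n" and gn: "\<And>x. x \<in> F \<times> F \<Longrightarrow> g x = (c n (fst x), x \<in> r n)"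
    unfolding infinite_nat_iff_unbounded_le by fastforce
  have "F \<subseteq> {i\<in>I. to_nat_on I i < n}" using m n F(1) by fastforce
  then have "disjointifiable \<mu> \<epsilon> F R (c n) (r n)"
    by (rule disjointifiable_subset[OF cr _ finite_to_nat_on_less[OF \<open>countable I\<close>]]) (simp add: R)
  moreover have "disjointifiable \<mu> \<epsilon> F R (\<lambda>i. fst (g (i, i))) {x. snd (g x)} \<longleftrightarrow>
      disjointifiable \<mu> \<epsilon> F R (c n) (r n)"
    by (rule disjointifiable_cong) (simp_all add: gn)
  ultimately show "disjointifiable \<mu> \<epsilon> F R (\<lambda>i. fst (g (i, i))) {x. snd (g x)}" by simp
qed

section \<open>Sparseness of the classes\<close>

text \<open>The witness for \<open>i\<close> is the indicator of \<open>W i\<close>, that is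
  \<open>R i\<close> without its predecessors in the same class. Of two members of a class one
  precedes the other, so the later \<open>W\<close> avoids the earlier set; this gives disjointness
  without any well-foundedness.\<close>

lemma disjointifiable_class_is_sparse:
  assumes "countable I" and R: "\<And>i. i \<in> I \<Longrightarrow> R i \<in> sets \<mu>"
    and fin: "\<And>i. i \<in> I \<Longrightarrow> emeasure \<mu> (R i) < \<infinity>"
    and dis: "disjointifiable \<mu> (1 - \<gamma>) I R c r" and "0 \<le> \<gamma>" "\<gamma> \<le> 1"
  shows "is_sparse \<mu> {i\<in>I. c i = q} R \<gamma>"
proof -
  define A where "A = {i\<in>I. c i = q}"
  define U where "U i = (\<Union>k\<in>{k\<in>I - {i}. c k = c i \<and> (k, i) \<in> r}. R k)" for i
  define W where "W i = R i - U i" for i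
  have AI: "A \<subseteq> I" by (auto simp: A_def)
  have U_sets: "U i \<in> sets \<mu>" for i
    unfolding U_def using R \<open>countable I\<close>
    by (intro sets.countable_UN') (auto intro: countable_subset)
  have W_sets: "W i \<in> sets \<mu>" if "i \<in> I" for i unfolding W_def using R[OF that] U_sets by auto
  have W_large: "ennreal \<gamma> * emeasure \<mu> (R i) \<le> emeasure \<mu> (W i)" if i: "i \<in> I" for i
  proof -
    have "emeasure \<mu> (R i \<inter> U i) \<le> ennreal (1 - \<gamma>) * emeasure \<mu> (R i)"
      using dis i by (auto simp: disjointifiable_def U_def)
    moreover have "emeasure \<mu> (R i) = emeasure \<mu> (R i \<inter> U i) + emeasure \<mu> (W i)"
      unfolding W_def using R[OF i] U_sets[of i]
      by (subst plus_emeasure) (auto intro!: arg_cong[where f="emeasure \<mu>"])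
    \<comment> \<open>Splitting off the share 1 - \<gamma> leaves a common summand, which can be
      cancelled in \<open>ennreal\<close> because \<open>R i\<close> has finite measure.\<close>
    moreover have "emeasure \<mu> (R i) = ennreal (1 - \<gamma>) * emeasure \<mu> (R i) + ennreal \<gamma> * emeasure \<mu> (R i)"
      using \<open>0 \<le> \<gamma>\<close> \<open>\<gamma> \<le> 1\<close> by (simp flip: distrib_right ennreal_plus)
    ultimately have "ennreal (1 - \<gamma>) * emeasure \<mu> (R i) + ennreal \<gamma> * emeasure \<mu> (R i) \<le>
        ennreal (1 - \<gamma>) * emeasure \<mu> (R i) + emeasure \<mu> (W i)"
      by (metis add_right_mono)
    then show ?thesis
      using fin[OF i] by (auto simp: ennreal_add_left_cancel_le ennreal_mult_eq_top_iff)
  qed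
  have W_disjoint: "i = j" if "i \<in> A" "j \<in> A" "x \<in> W i" "x \<in> W j" for i j x
  proof (rule ccontr)
    assume "i \<noteq> j"
    then have "(i, j) \<in> r \<or> (j, i) \<in> r"
      using dis that AI by (auto simp: disjointifiable_def total_on_def)
    then show False using that \<open>i \<noteq> j\<close> by (auto simp: W_def U_def A_def)
  qed
  show ?thesis
    unfolding is_sparse_def A_def[symmetric]
  proof (intro exI[of _ "\<lambda>i. indicator (W i)"] conjI ballI)
    fix i assume i: "i \<in> A"
    then show "indicator (W i) \<in> borel_measurable \<mu>" using W_sets AI by auto
    have "(\<integral>\<^sup>+x\<in>R i. indicator (W i) x \<partial>\<mu>) = (\<integral>\<^sup>+x. indicator (W i) x \<partial>\<mu>)"
      by (intro nn_integral_cong) (auto simp: W_def indicator_def)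
    also have "\<dots> = emeasure \<mu> (W i)" using W_sets i AI by auto
    finally show "ennreal \<gamma> * emeasure \<mu> (R i) \<le> (\<integral>\<^sup>+x\<in>R i. indicator (W i) x \<partial>\<mu>)"
      using W_large i AI by auto
  next
    fix x
    show "(\<Sum>\<^sub>\<infinity>i\<in>A. indicator (W i) x) \<le> (1::ennreal)"
    proof (cases "\<exists>i\<in>A. x \<in> W i")
      case True
      then obtain i where i: "i \<in> A" "x \<in> W i" by blast
      have "(\<Sum>\<^sub>\<infinity>i\<in>A. indicator (W i) x) = (\<Sum>\<^sub>\<infinity>k\<in>{i}. indicator (W k) x :: ennreal)"
        using i W_disjoint by (intro infsum_cong_neutral) (auto simp: indicator_def)
      then show ?thesis using i by simp
    next
      case False
      then have "(\<Sum>\<^sub>\<infinity>i\<in>A. indicator (W i) x) = (0::ennreal)"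
        by (intro infsum_0) auto
      then show ?thesis by simp
    qed
  qed
qed

lemma sparse_const_ge:
  assumes "is_sparse \<mu> A R \<gamma>" "0 \<le> \<gamma>"
  shows "ennreal \<gamma> \<le> sparse_const \<mu> A R"
  unfolding sparse_const_def by (rule SUP_upper) (use assms in auto)

text \<open>Serves the case of an infinite bound, where the partition into singletons
  suffices.\<close>

lemma is_sparse_singleton:
  assumes "R i \<in> sets \<mu>" "0 \<le> \<gamma>" "\<gamma> \<le> 1"
  shows "is_sparse \<mu> {i} R \<gamma>"
proof -
  have "ennreal \<gamma> * emeasure \<mu> (R i) \<le> 1 * emeasure \<mu> (R i)"
    using assms by (intro mult_right_mono) (auto simp: ennreal_le_1)
  then show ?thesis
    unfolding is_sparse_def
    by (intro exI[of _ "\<lambda>_ _. 1"]) (use assms in auto)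
qed

section \<open>The partition and the number of its classes\<close>

lemma exists_sparse_partition_card_le:
  fixes \<mu> :: "'a measure" and I :: "'i set" and R :: "'i \<Rightarrow> 'a set" and \<eta> \<gamma> :: real
  assumes I: "countable I" and R: "\<And>i. i \<in> I \<Longrightarrow> R i \<in> sets \<mu>"
    and fin: "\<And>i. i \<in> I \<Longrightarrow> emeasure \<mu> (R i) < \<infinity>"
    and "0 \<le> \<eta>"
    and weak: "\<And>E. E \<in> sets \<mu> \<Longrightarrow>
           emeasure \<mu> {x. maximal_op \<mu> I R (indicator E) x > ennreal \<eta>} \<le> M * emeasure \<mu> E"
    and "0 < \<gamma>" and \<gamma>: "\<gamma> < 1 - \<eta>"
    and K: "2 * M * carleson_const \<mu> I R = ennreal K" "0 \<le> K"
    and N: "0 < N" "K * (1 - \<eta>) \<le> real N * (1 - \<eta> - \<gamma>)"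
  shows "\<exists>P. partition_on I P \<and> finite P \<and> card P \<le> N \<and> (\<forall>A\<in>P. is_sparse \<mu> A R \<gamma>)"
proof -
  have MC: "M * carleson_const \<mu> I R < \<infinity>"
  proof (rule ccontr)
    assume "\<not> ?thesis"
    then have "2 * M * carleson_const \<mu> I R = \<infinity>"
      by (simp add: mult.assoc less_top[symmetric] ennreal_mult_top)
    then show False using K by simp
  qed
  \<comment> \<open>A null set can always go last, as it overlaps every class in measure 0. If there
    is none, the multiplicity argument picks \<open>i\<close> from \<open>G\<close> alone, and
    \<open>q\<close> is found once \<open>c\<close> is given.\<close>
  have last: "\<exists>i\<in>G. \<forall>c::'i \<Rightarrow> nat. \<exists>q<N.
      emeasure \<mu> (R i \<inter> (\<Union>k\<in>{k\<in>G - {i}. c k = q}. R k)) \<le> ennreal (1 - \<gamma>) * emeasure \<mu> (R i)"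
    if G: "G \<subseteq> I" "finite G" "G \<noteq> {}" for G
  proof (cases "\<exists>i\<in>G. emeasure \<mu> (R i) = 0")
    case True
    then obtain i where i: "i \<in> G" "emeasure \<mu> (R i) = 0" by blast
    have "emeasure \<mu> (R i \<inter> X) = 0" for X
      by (rule emeasure_eq_0[of "R i"]) (use i G R in auto)
    then show ?thesis using i N by (intro bexI[of _ i]) auto
  next
    case False
    define B where "B = {x \<in> space \<mu>. ennreal K < (\<Sum>i\<in>G. indicator (R i) x)}"
    have pos: "\<And>i. i \<in> G \<Longrightarrow> emeasure \<mu> (R i) > 0" using False by (auto simp: zero_less_iff_neq_zero)
    have "\<exists>i\<in>G. emeasure \<mu> (R i \<inter> B) \<le> ennreal \<eta> * emeasure \<mu> (R i)"
      by (rule exists_set_with_few_heavy_points[OF I R fin pos \<open>0 \<le> \<eta>\<close> weak MC G(2,1,3)])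
        (auto simp: B_def K)
    then obtain i where i: "i \<in> G" "emeasure \<mu> (R i \<inter> B) \<le> ennreal \<eta> * emeasure \<mu> (R i)" by blast
    have "\<exists>q<N. emeasure \<mu> (R i \<inter> (\<Union>k\<in>{k\<in>G - {i}. c k = q}. R k)) \<le> ennreal (1 - \<gamma>) * emeasure \<mu> (R i)"
      for c :: "'i \<Rightarrow> nat"
      by (rule exists_class_with_small_overlap[OF G(2) _ i(1) pos[OF i(1)] _ K(2) B_def i(2)
            \<open>0 \<le> \<eta>\<close> \<open>0 < \<gamma>\<close> \<gamma> N]) (use G i R fin in auto)
    then show ?thesis using i by blast
  qed
  have finite_case: "\<exists>c r. range c \<subseteq> {..<N} \<and> disjointifiable \<mu> (1 - \<gamma>) F R c r"
    if "F \<subseteq> I" "finite F" for F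
  proof (rule finite_disjointifiable[OF that(2) N(1)])
    fix G assume "G \<subseteq> F" "G \<noteq> {}"
    then show "\<exists>i\<in>G. \<forall>c::'i \<Rightarrow> nat. \<exists>q<N.
        emeasure \<mu> (R i \<inter> (\<Union>k\<in>{k\<in>G - {i}. c k = q}. R k)) \<le> ennreal (1 - \<gamma>) * emeasure \<mu> (R i)"
      using that finite_subset by (intro last) auto
  qed
  \<comment> \<open>The data chosen for different initial segments need not be compatible, which is
    why a limit has to be extracted.\<close>
  have "\<forall>n. \<exists>p. range (fst p) \<subseteq> {..<N} \<and>
      disjointifiable \<mu> (1 - \<gamma>) {i\<in>I. to_nat_on I i < n} R (fst p) (snd p)"
    using finite_case[OF _ finite_to_nat_on_less[OF I]] by simp
  from choice[OF this] obtain p where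
    p: "\<And>n. range (fst (p n)) \<subseteq> {..<N} \<and>
      disjointifiable \<mu> (1 - \<gamma>) {i\<in>I. to_nat_on I i < n} R (fst (p n)) (snd (p n))"
    by blast
  define c where "c n = fst (p n)" for n
  define r where "r n = snd (p n)" for n
  have c: "range (c n) \<subseteq> {..<N}"
    and cr: "disjointifiable \<mu> (1 - \<gamma>) {i\<in>I. to_nat_on I i < n} R (c n) (r n)" for n
    using p[of n] by (simp_all add: c_def r_def)
  have "finite (range (\<lambda>n. (c n (fst x), x \<in> r n)))" for x
  proof (rule finite_subset)
    show "range (\<lambda>n. (c n (fst x), x \<in> r n)) \<subseteq> {..<N} \<times> UNIV" using c by blast
  qed simp
  then obtain g where g: "\<And>X. X \<subseteq> I \<times> I \<Longrightarrow> finite X \<Longrightarrow>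
      infinite {n. \<forall>x\<in>X. (c n (fst x), x \<in> r n) = g x}"
    using countable_eventually_constant_limit[of "I \<times> I" "\<lambda>n x. (c n (fst x), x \<in> r n)"] I by auto
  define d where "d i = fst (g (i, i))" for i
  have dr: "disjointifiable \<mu> (1 - \<gamma>) I R d {x. snd (g x)}"
    unfolding d_def by (rule disjointifiable_limit[OF I R cr g])
  have d: "d ` I \<subseteq> {..<N}"
  proof clarify
    fix i assume "i \<in> I"
    then have "\<exists>n. (c n i, (i, i) \<in> r n) = g (i, i)"
      using infinite_imp_nonempty[OF g[of "{(i, i)}"]] by auto
    then show "d i < N" using c by (metis d_def fst_conv lessThan_iff range_subsetD)
  qed
  \<comment> \<open>Only classes attained on \<open>I\<close> are used, because a partition has no
    empty blocks.\<close>
  define P where "P = (\<lambda>q. {i\<in>I. d i = q}) ` (d ` I)"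
  have "partition_on I P"
    by (rule partition_onI) (auto simp: P_def disjnt_def)
  moreover have "finite P" unfolding P_def using d finite_subset by blast
  moreover have "card P \<le> N"
    unfolding P_def
    by (rule order_trans[OF card_image_le]) (use d finite_subset card_mono[of "{..<N}"] in auto)
  moreover have "\<forall>A\<in>P. is_sparse \<mu> A R \<gamma>"
    unfolding P_def using disjointifiable_class_is_sparse[OF I R fin dr] \<gamma> \<open>0 \<le> \<eta>\<close> \<open>0 < \<gamma>\<close> by auto
  ultimately show ?thesis by blast
qed

lemma exists_sparse_partition:
  fixes \<mu> :: "'a measure" and I :: "'i set" and R :: "'i \<Rightarrow> 'a set" and \<eta> \<gamma> :: real
  assumes I: "countable I" and R: "\<And>i. i \<in> I \<Longrightarrow> R i \<in> sets \<mu>"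
    and fin: "\<And>i. i \<in> I \<Longrightarrow> emeasure \<mu> (R i) < \<infinity>"
    and "0 \<le> \<eta>"
    and weak: "\<And>E. E \<in> sets \<mu> \<Longrightarrow>
           emeasure \<mu> {x. maximal_op \<mu> I R (indicator E) x > ennreal \<eta>} \<le> M * emeasure \<mu> E"
    and "0 < \<gamma>" and \<gamma>: "\<gamma> < 1 - \<eta>"
  shows "\<exists>P. partition_on I P \<and>
           num_elems P \<le> 1 + 2 * M * ennreal (1 - \<eta>) / ennreal (1 - \<eta> - \<gamma>) * carleson_const \<mu> I R \<and>
           (\<forall>A\<in>P. sparse_const \<mu> A R \<ge> ennreal \<gamma>)"
proof -
  define C where "C = carleson_const \<mu> I R"
  define t where "t = (1 - \<eta>) / (1 - \<eta> - \<gamma>)"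
  have t: "t > 0" using \<open>0 < \<gamma>\<close> \<gamma> by (simp add: t_def)
  have "ennreal (1 - \<eta>) / ennreal (1 - \<eta> - \<gamma>) = ennreal t"
    unfolding t_def using \<open>0 < \<gamma>\<close> \<gamma> by (intro divide_ennreal) auto
  then have bound: "2 * M * ennreal (1 - \<eta>) / ennreal (1 - \<eta> - \<gamma>) * C = 2 * M * C * ennreal t"
    by (simp add: ac_simps flip: ennreal_times_divide)
  show ?thesis
  proof (cases "2 * M * C = \<infinity>")
    \<comment> \<open>The bound is infinite since t > 0, so even infinitely many singletons are
      admissible.\<close>
    case True
    then have "2 * M * C * ennreal t = \<infinity>" using t by (simp add: ennreal_top_mult)
    moreover have "partition_on I ((\<lambda>i. {i}) ` I)"
      by (rule partition_onI) (auto simp: disjnt_def)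
    moreover have "\<forall>A\<in>(\<lambda>i. {i}) ` I. ennreal \<gamma> \<le> sparse_const \<mu> A R"
    proof clarify
      fix i assume "i \<in> I"
      then show "ennreal \<gamma> \<le> sparse_const \<mu> {i} R"
        using \<open>0 \<le> \<eta>\<close> \<open>0 < \<gamma>\<close> \<gamma> by (intro sparse_const_ge is_sparse_singleton R) simp_all
    qed
    ultimately show ?thesis
      unfolding C_def[symmetric] bound by (intro exI[of _ "(\<lambda>i. {i}) ` I"]) simp
  next
    case False
    define K where "K = enn2real (2 * M * C)"
    have K: "2 * M * C = ennreal K" "0 \<le> K" using False by (auto simp: K_def less_top)
    \<comment> \<open>The least natural number above K t. It is positive even for K = 0 and at most
      1 + K t, which is where the summand 1 of the bound comes from.\<close>
    define N where "N = nat \<lfloor>K * t\<rfloor> + 1"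
    have "K * t \<ge> 0" using K t by simp
    then have N_le: "real N \<le> 1 + K * t" and N_ge: "K * t \<le> real N" by (simp_all add: N_def) linarith+
    from N_ge have "K * (1 - \<eta>) \<le> real N * (1 - \<eta> - \<gamma>)"
      using \<gamma> by (simp add: t_def pos_divide_le_eq)
    then obtain P where P: "partition_on I P" "finite P" "card P \<le> N" "\<forall>A\<in>P. is_sparse \<mu> A R \<gamma>"
      using exists_sparse_partition_card_le[OF I R fin \<open>0 \<le> \<eta>\<close> weak \<open>0 < \<gamma>\<close> \<gamma>, of K N] K
      by (auto simp: C_def N_def)
    have "num_elems P = ennreal (real (card P))"
      using P by (simp add: num_elems_def ennreal_of_nat_eq_real_of_nat)
    also have "\<dots> \<le> ennreal (1 + K * t)" using P N_le by (intro ennreal_leI) linarith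
    also have "\<dots> = 1 + 2 * M * C * ennreal t"
      using K t by (simp add: ennreal_mult)
    finally have "num_elems P \<le> 1 + 2 * M * C * ennreal t" .
    then show ?thesis
      unfolding C_def[symmetric] bound using P \<open>0 < \<gamma>\<close>
      by (intro exI[of _ P]) (auto intro!: sparse_const_ge)
  qed
qed

theorem theorem4p1:
  fixes \<mu> :: "(real ^ 'd) measure"
    and I :: "'i set"
    and R :: "'i \<Rightarrow> (real ^ 'd) set"
    and M :: ennreal
    and \<eta> \<gamma> :: real
  assumes "space \<mu> = UNIV" and "sets borel \<subseteq> sets \<mu>"
    and "countable I"
    and "\<And>i. i \<in> I \<Longrightarrow> R i \<in> sets \<mu>"
    and "\<And>i. i \<in> I \<Longrightarrow> emeasure \<mu> (R i) < \<infinity>"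
    and "0 < \<eta>" and "\<eta> < 1"
    and "M < \<infinity>"
    and "\<And>E. E \<in> sets \<mu> \<Longrightarrow>
           emeasure \<mu> {x. maximal_op \<mu> I R (indicator E) x > ennreal \<eta>} \<le> M * emeasure \<mu> E"
    and "0 < \<gamma>" and "\<gamma> < 1 - \<eta>"
  shows "\<exists>P. partition_on I P \<and>
           num_elems P \<le> 1 + 2 * M * ennreal (1 - \<eta>) / ennreal (1 - \<eta> - \<gamma>) * carleson_const \<mu> I R \<and>
           (\<forall>A\<in>P. sparse_const \<mu> A R \<ge> ennreal \<gamma>)"
  by (rule exists_sparse_partition[OF assms(3,4,5) less_imp_le[OF assms(6)] assms(9,10,11)])

end
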